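(* $N(96) \ge 8$; that is, there exist $8$ mutually orthogonal Latin squares of order $96$.
   Context: A Latin square of order $n$ on an $n$-element set $V$ is an $n\times n$ matrix every row and every column of which is a permutation of $V$. Two Latin squares $L_1=(v_{ij})$ and $L_2=(w_{ij})$ of order $n$ (on symbol sets $V$, $W$ of size $n$) are orthogonal if the $n^2$ pairs $(v_{ij},w_{ij})$ are all distinct, i.e. they exhaust $V\times W$. A set of Latin squares is a set of mutually orthogonal Latin squares (MOLS) if any two of them are orthogonal. $N(n)$ denotes the largest size of a set of MOLS of order $n$. *)

theory Defs
  imports "Jordan_Normal_Form.Matrix" "HOL-Library.Extended_Nat"
begin

definition latin_square :: "nat \<Rightarrow> 'a set \<Rightarrow> 'a mat \<Rightarrow> bool" where
  "latin_square n V L \<longleftrightarrow>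
     finite V \<and> card V = n \<and> L \<in> carrier_mat n n \<and>
     (\<forall>i<n. bij_betw (\<lambda>j. L $$ (i, j)) {..<n} V) \<and>
     (\<forall>j<n. bij_betw (\<lambda>i. L $$ (i, j)) {..<n} V)"

definition orthogonal_squares :: "nat \<Rightarrow> 'a mat \<Rightarrow> 'b mat \<Rightarrow> bool" where
  "orthogonal_squares n L1 L2 \<longleftrightarrow>
     inj_on (\<lambda>(i, j). (L1 $$ (i, j), L2 $$ (i, j))) ({..<n} \<times> {..<n})"

text \<open>Each square of the set may have its own symbol set.\<close>

definition mols :: "nat \<Rightarrow> 'a mat set \<Rightarrow> bool" where
  "mols n M \<longleftrightarrow>
     (\<forall>L\<in>M. \<exists>V. latin_square n V L) \<and> pairwise (orthogonal_squares n) M"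

text \<open>
  Symbols are natural numbers, which loses no generality since every \<open>n\<close>-element set embeds
  into them. For \<open>n \<ge> 2\<close> the sizes are bounded and the supremum is the maximum; the
  codomain \<^typ>\<open>enat\<close> avoids an unspecified value for \<open>n = 1\<close>, where arbitrarily many
  squares (on different symbol sets) are mutually orthogonal.
\<close>

definition mols_number :: "nat \<Rightarrow> enat" where
  "mols_number n = Sup {enat (card M) | M :: nat mat set. finite M \<and> mols n M}"

end

theory Submission
  imports Defs "HOL-Algebra.Elementary_Groups"
begin

text \<open>
  A \<open>(G, 9; 1)\<close>-difference matrix over a group \<open>G\<close> of order 96 yields 8 MOLS: the square
  attached to the row \<open>r \<noteq> 0\<close> has the entries \<open>x - D 0 c + D r c\<close>, where \<open>x\<close> runs over \<open>G\<close> and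
  \<open>c\<close> over the 96 columns.

  The matrix is taken over the product of \<open>F = GF(2)^5\<close> and \<open>Z/3\<close>. Its columns are closed under an
  action of \<open>T = GF(2)^3\<close> by translations: \<open>t\<close> adds \<open>A r t\<close> to the \<open>F\<close>-part of the row \<open>r\<close>, where
  \<open>A r : T \<rightarrow> F\<close> is linear and \<open>A r - A s\<close> is injective for \<open>r \<noteq> s\<close>. This leaves \<open>96 / 8 = 12\<close> base
  columns. They have to form a \<open>(Z/3, 9; 4)\<close>-difference matrix in the second component, and for
  two rows \<open>r, s\<close> the \<open>F\<close>-differences of the four base columns with a given \<open>Z/3\<close>-difference have
  to represent the four cosets of the image of \<open>A r - A s\<close>.
\<close>

section \<open>Families of pairwise orthogonal squares\<close>

text \<open>The symbol of cell (0, 0) recurs in row 1, so the pair it forms with itself occurs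
  twice. Hence squares with distinct indices in an orthogonal family are distinct, and none is lost
  in the image set.\<close>

lemma latin_square_not_self_orthogonal:
  assumes "latin_square n V L" and "n \<ge> 2"
  shows "\<not> orthogonal_squares n L L"
proof
  assume orth: "orthogonal_squares n L L"
  have row: "bij_betw (\<lambda>j. L $$ (i, j)) {..<n} V" if "i < n" for i
    using assms(1) that by (simp add: latin_square_def)
  have "L $$ (0, 0) \<in> V"
    using row[of 0] assms(2) by (auto simp: bij_betw_def)
  then obtain j where "j < n" and "L $$ (1, j) = L $$ (0, 0)"
    using row[of 1] assms(2) by (force simp: bij_betw_def)
  then show False
    using inj_onD[OF orth[unfolded orthogonal_squares_def], of "(1, j)" "(0, 0)"] assms(2) by simp
qed

lemma mols_of_family:
  assumes "n \<ge> 2"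
    and latin: "\<And>r. r \<in> R \<Longrightarrow> \<exists>V. latin_square n V (L r)"
    and orth: "\<And>r s. r \<in> R \<Longrightarrow> s \<in> R \<Longrightarrow> r \<noteq> s \<Longrightarrow> orthogonal_squares n (L r) (L s)"
  shows "mols n (L ` R) \<and> card (L ` R) = card R"
proof
  show "mols n (L ` R)"
    using latin orth by (force simp: mols_def pairwise_def)
  have "inj_on L R"
    using latin orth latin_square_not_self_orthogonal[OF _ assms(1)]
    by (metis inj_onI)
  then show "card (L ` R) = card R"
    by (rule card_image)
qed

section \<open>Latin squares from difference matrices\<close>

definition difference_matrix ::
    "('a, 'b) monoid_scheme \<Rightarrow> 'r set \<Rightarrow> 'c set \<Rightarrow> ('r \<Rightarrow> 'c \<Rightarrow> 'a) \<Rightarrow> bool" where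
  "difference_matrix G R C D \<longleftrightarrow>
     (\<forall>r\<in>R. \<forall>c\<in>C. D r c \<in> carrier G) \<and>
     (\<forall>r\<in>R. \<forall>s\<in>R. r \<noteq> s \<longrightarrow>
        bij_betw (\<lambda>c. inv\<^bsub>G\<^esub> D r c \<otimes>\<^bsub>G\<^esub> D s c) C (carrier G))"

text \<open>Exchanging two rows inverts their quotients, so the pairs with \<open>r < s\<close>
  suffice; as there are as many columns as group elements, injectivity gives bijectivity.\<close>

lemma (in group) difference_matrixI:
  fixes R :: "'r::linorder set"
  assumes fin: "finite (carrier G)" "card C = order G"
    and closed: "\<And>r c. r \<in> R \<Longrightarrow> c \<in> C \<Longrightarrow> D r c \<in> carrier G"
    and inj: "\<And>r s. r \<in> R \<Longrightarrow> s \<in> R \<Longrightarrow> r < s \<Longrightarrow> inj_on (\<lambda>c. inv D r c \<otimes> D s c) C"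
  shows "difference_matrix G R C D"
  unfolding difference_matrix_def
proof (intro conjI ballI impI)
  fix r s assume rs: "r \<in> R" "s \<in> R" "r \<noteq> s"
  have "inj_on (\<lambda>c. inv D r c \<otimes> D s c) C"
  proof (cases "r < s")
    case False
    have "inv D r c \<otimes> D s c = inv (inv D s c \<otimes> D r c)" if "c \<in> C" for c
      using that rs closed by (simp add: inv_mult_group)
    moreover have "inj_on (\<lambda>c. inv (inv D s c \<otimes> D r c)) C"
      using inj[of s r] rs False closed by (auto simp: inj_on_def)
    ultimately show ?thesis
      by (simp cong: inj_on_cong)
  qed (use rs inj in blast)
  moreover have "(\<lambda>c. inv D r c \<otimes> D s c) ` C \<subseteq> carrier G"
    using rs closed by auto
  ultimately show "bij_betw (\<lambda>c. inv D r c \<otimes> D s c) C (carrier G)"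
    using fin by (simp add: bij_betw_def card_image card_subset_eq order_def)
qed (use closed in blast)

lemma (in group) inv_mult_mult_cancel:
  assumes "x \<in> carrier G" "a \<in> carrier G" "b \<in> carrier G"
  shows "inv (x \<otimes> a) \<otimes> (x \<otimes> b) = inv a \<otimes> b"
proof -
  have "inv x \<otimes> (x \<otimes> b) = b"
    using assms by (simp flip: m_assoc)
  then show ?thesis
    using assms by (simp add: inv_mult_group m_assoc)
qed

theorem (in group) mols_of_difference_matrix:
  assumes fin: "finite (carrier G)" and n: "order G = n" "n \<ge> 2"
    and C: "card C = n"
    and D: "difference_matrix G R C D" and r0: "r0 \<in> R"
  shows "\<exists>M :: nat mat set. mols n M \<and> card M = card R - 1"
proof -
  have finC: "finite C"
    using C n(2) by (intro card_ge_0_finite) simp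
  obtain e where e: "bij_betw e {..<n} (carrier G)"
    using ex_bij_betw_nat_finite[OF fin] n(1) by (auto simp: order_def atLeast0LessThan)
  obtain col where col: "bij_betw col {..<n} C"
    using ex_bij_betw_nat_finite[OF finC] C by (auto simp: atLeast0LessThan)
  obtain h :: "'a \<Rightarrow> nat" where h: "bij_betw h (carrier G) {..<n}"
    using e bij_betw_inv by blast
  have e_in: "e i \<in> carrier G" if "i < n" for i
    using e that by (auto simp: bij_betw_def)
  have col_in: "col j \<in> C" if "j < n" for j
    using col that by (auto simp: bij_betw_def)
  have closed: "D r c \<in> carrier G" if "r \<in> R" "c \<in> C" for r c
    using D that by (simp add: difference_matrix_def)
  have bij: "bij_betw (\<lambda>c. inv D r c \<otimes> D s c) C (carrier G)" if "r \<in> R" "s \<in> R" "r \<noteq> s" for r s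
    using D that by (simp add: difference_matrix_def)
  \<comment> \<open>Each column is normalized by its entry in row \<open>r0\<close>. Since
    \<open>E r0 x c = x\<close>, that row gives no Latin square, which accounts for the loss of one
    row.\<close>
  define E where "E r x c = x \<otimes> (inv D r0 c \<otimes> D r c)" for r x c
  define L where "L r = mat n n (\<lambda>(i, j). h (E r (e i) (col j)))" for r
  have E_in: "E r x c \<in> carrier G" if "r \<in> R" "x \<in> carrier G" "c \<in> C" for r x c
    using that closed r0 by (simp add: E_def)
  have L_entry: "L r $$ (i, j) = h (E r (e i) (col j))" if "i < n" "j < n" for r i j
    using that by (simp add: L_def)
  have latin: "latin_square n {..<n} (L r)" if r: "r \<in> R - {r0}" for r
    unfolding latin_square_def
  proof (intro conjI allI impI)
    fix i assume i: "i < n"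
    have "bij_betw (\<lambda>y. e i \<otimes> y) (carrier G) (carrier G)"
      using e_in[OF i] by (simp add: bij_betw_def inj_on_cmult surj_const_mult)
    from bij_betw_trans[OF bij_betw_trans[OF bij_betw_trans[OF col bij[of r0 r]] this] h]
    have "bij_betw (\<lambda>j. h (E r (e i) (col j))) {..<n} {..<n}"
      using r r0 by (auto simp: E_def comp_def)
    then show "bij_betw (\<lambda>j. L r $$ (i, j)) {..<n} {..<n}"
      using i by (subst bij_betw_cong) (auto simp: L_entry)
  next
    fix j assume j: "j < n"
    define d where "d = inv D r0 (col j) \<otimes> D r (col j)"
    have d: "d \<in> carrier G"
      using closed[OF _ col_in[OF j]] r r0 by (simp add: d_def)
    have "bij_betw (\<lambda>x. x \<otimes> d) (carrier G) (carrier G)"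
    proof (rule bij_betw_byWitness[where f' = "\<lambda>x. x \<otimes> inv d"])
    qed (use d in \<open>auto simp: m_assoc\<close>)
    from bij_betw_trans[OF bij_betw_trans[OF e this] h]
    have "bij_betw (\<lambda>i. h (E r (e i) (col j))) {..<n} {..<n}"
      by (simp add: E_def d_def comp_def)
    then show "bij_betw (\<lambda>i. L r $$ (i, j)) {..<n} {..<n}"
      using j by (subst bij_betw_cong) (auto simp: L_entry)
  qed (simp_all add: L_def)
  have orth: "orthogonal_squares n (L r) (L s)"
    if r: "r \<in> R - {r0}" and s: "s \<in> R - {r0}" and "r \<noteq> s" for r s
    unfolding orthogonal_squares_def
  proof (rule inj_onI, clarsimp)
    fix i j i' j' assume less: "i < n" "j < n" "i' < n" "j' < n"
      and Lr: "L r $$ (i, j) = L r $$ (i', j')" and Ls: "L s $$ (i, j) = L s $$ (i', j')"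
    have quotient: "inv E r x c \<otimes> E s x c = inv D r c \<otimes> D s c"
      if "x \<in> carrier G" "c \<in> C" for x c
      using that closed r s r0 by (simp add: E_def inv_mult_mult_cancel)
    have eq: "E q (e i) (col j) = E q (e i') (col j')"
      if "q \<in> R" "L q $$ (i, j) = L q $$ (i', j')" for q
      using that less E_in[OF that(1) e_in col_in] h by (auto simp: L_entry bij_betw_def dest: inj_onD)
    \<comment> \<open>The factor \<open>x\<close> cancels from the quotient of the two entries, so
      the symbol pair determines the column first and then \<open>x\<close>.\<close>
    have "inv D r (col j) \<otimes> D s (col j) = inv D r (col j') \<otimes> D s (col j')"
      using quotient[OF e_in col_in] eq[OF _ Lr] eq[OF _ Ls] r s less by (metis DiffD1)
    then have "col j = col j'"
      using bij[of r s] r s \<open>r \<noteq> s\<close> col_in less by (auto simp: bij_betw_def dest: inj_onD)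
    moreover from this have "e i = e i'"
      using eq[OF _ Lr] r r0 less e_in closed col_in by (simp add: E_def)
    ultimately show "i = i' \<and> j = j'"
      using e col less by (auto simp: bij_betw_def dest: inj_onD)
  qed
  have "mols n (L ` (R - {r0})) \<and> card (L ` (R - {r0})) = card (R - {r0})"
    by (rule mols_of_family[OF n(2)]) (use latin orth in blast)+
  then show ?thesis
    using r0 by (auto simp: card_Diff_singleton)
qed

section \<open>Binary vectors and the encoding of rows\<close>

unbundle bit_operations_syntax

definition xor_group :: "nat \<Rightarrow> int monoid" where
  "xor_group m = \<lparr>carrier = {0..<2 ^ m}, monoid.mult = (XOR), one = 0\<rparr>"

lemma xor_group_simps [simp]:
  "carrier (xor_group m) = {0..<2 ^ m}"
  "x \<otimes>\<^bsub>xor_group m\<^esub> y = x XOR y"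
  "\<one>\<^bsub>xor_group m\<^esub> = 0"
  by (simp_all add: xor_group_def)

lemma group_xor_group [simp]: "group (xor_group m)"
proof (rule groupI)
  fix x assume "x \<in> carrier (xor_group m)"
  then show "\<exists>y\<in>carrier (xor_group m). y \<otimes>\<^bsub>xor_group m\<^esub> x = \<one>\<^bsub>xor_group m\<^esub>"
    by (intro bexI[of _ x]) auto
qed (auto simp: XOR_upper ac_simps)

lemma inv_xor_group [simp]: "x \<in> carrier (xor_group m) \<Longrightarrow> inv\<^bsub>xor_group m\<^esub> x = x"
  by (rule group.inv_equality) auto

text \<open>
  A row of the matrix is stored as the images of the three unit vectors under the linear map
  \<open>A r\<close>, together with the entries in the twelve base columns; vectors of \<open>F\<close> are binary numbers.
\<close>

type_synonym row = "(int \<times> int \<times> int) \<times> (int \<times> int) list"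

fun xor_comb :: "int \<times> int \<times> int \<Rightarrow> bool \<times> bool \<times> bool \<Rightarrow> int" where
  "xor_comb (a, b, c) (p, q, r) = of_bool p * a XOR of_bool q * b XOR of_bool r * c"

fun row_entry :: "row \<Rightarrow> nat \<times> bool \<times> bool \<times> bool \<Rightarrow> int \<times> int" where
  "row_entry (A, xs) (j, t) = (fst (xs ! j) XOR xor_comb A t, snd (xs ! j))"

text \<open>Entries are affine in \<open>t\<close>, so the quotient of two rows again has the format
  of a row. This turns the condition on a pair of rows into one on a single row.\<close>

fun row_diff :: "row \<Rightarrow> row \<Rightarrow> row" where
  "row_diff ((a, b, c), xs) ((a', b', c'), ys) =
     ((a XOR a', b XOR b', c XOR c'),
      map2 (\<lambda>(x, u) (y, v). (x XOR y, (v - u) mod 3)) xs ys)"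

fun nonzero_combs :: "int \<times> int \<times> int \<Rightarrow> int list" where
  "nonzero_combs (a, b, c) =
     [a, b, c, a XOR b, a XOR c, b XOR c, a XOR b XOR c]"

text \<open>A finite test by evaluation: \<open>A\<close> has trivial kernel, and base entries with
  equal \<open>Z/3\<close>-part lie in distinct cosets of its image.\<close>

fun row_injective :: "row \<Rightarrow> bool" where
  "row_injective (A, xs) \<longleftrightarrow>
     (let us = nonzero_combs A in
      0 \<notin> set us \<and>
      sorted_wrt (\<lambda>(x, u) (y, v). u = v \<longrightarrow> x XOR y \<noteq> 0 \<and> x XOR y \<notin> set us) xs)"

fun row_wf :: "row \<Rightarrow> bool" where
  "row_wf ((a, b, c), xs) \<longleftrightarrow>
     a \<in> {0..<32} \<and> b \<in> {0..<32} \<and> c \<in> {0..<32} \<and> length xs = 12 \<and>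
     set xs \<subseteq> {0..<32} \<times> {0..<3}"

text \<open>By linearity the left-hand side is the value of \<open>A\<close> at the nonzero vector
  \<open>t + t'\<close>.\<close>

lemma xor_comb_in_nonzero_combs:
  assumes "t \<noteq> t'"
  shows "xor_comb A t XOR xor_comb A t' \<in> set (nonzero_combs A)"
  using assms
  by (cases A; cases t; cases t') (auto simp: ac_simps of_bool_def split: if_splits)

lemma inj_on_row_entry:
  assumes "row_injective (A, xs)"
  shows "inj_on (row_entry (A, xs)) ({..<length xs} \<times> UNIV)"
proof -
  have nz: "0 \<notin> set (nonzero_combs A)"
    and sep: "\<And>i j. i < j \<Longrightarrow> j < length xs \<Longrightarrow> snd (xs ! i) = snd (xs ! j) \<Longrightarrow>
      fst (xs ! i) XOR fst (xs ! j) \<noteq> 0 \<and> fst (xs ! i) XOR fst (xs ! j) \<notin> set (nonzero_combs A)"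
    using assms by (auto simp: Let_def sorted_wrt_iff_nth_less split_beta)
  have xor_move: "x XOR y = u XOR v" if "x XOR u = y XOR v" for x y u v :: int
    using that by (metis (no_types, opaque_lifting) xor.assoc xor.commute xor_self_eq xor.right_neutral)
  have *: "i = j \<and> t = t'"
    if "i \<le> j" "j < length xs" "row_entry (A, xs) (i, t) = row_entry (A, xs) (j, t')" for i j t t'
  proof -
    have z: "snd (xs ! i) = snd (xs ! j)"
      using that(3) by simp
    have x: "fst (xs ! i) XOR fst (xs ! j) = xor_comb A t XOR xor_comb A t'"
      by (rule xor_move) (use that(3) in simp)
    have "i = j"
      using sep[of i j] that z x xor_comb_in_nonzero_combs[of t t' A]
      by (cases "t = t'") (auto simp: order_le_less)
    moreover from this have "t = t'"
      using nz x xor_comb_in_nonzero_combs[of t t' A] by auto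
    ultimately show ?thesis by blast
  qed
  show ?thesis
  proof (rule inj_onI)
    fix c c' assume cc: "c \<in> {..<length xs} \<times> UNIV" "c' \<in> {..<length xs} \<times> UNIV"
      and eq: "row_entry (A, xs) c = row_entry (A, xs) c'"
    obtain i t j t' where c: "c = (i, t)" "c' = (j, t')"
      by (cases c; cases c') blast
    have "i < length xs" "j < length xs"
      using cc c by auto
    then show "c = c'"
      \<comment> \<open>The test compares each pair of base columns in one order only, hence the
        case split on the order of \<open>i\<close> and \<open>j\<close>.\<close>
      using *[of i j t t'] *[of j i t' t] eq unfolding c by (metis nat_le_linear)
  qed
qed

section \<open>The difference matrix over the group of order 96\<close>

abbreviation G96 :: "(int \<times> int) monoid" where
  "G96 \<equiv> xor_group 5 \<times>\<times> integer_mod_group 3"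

lemma row_entry_closed:
  assumes "row_wf R" and "j < 12"
  shows "row_entry R (j, t) \<in> carrier G96"
proof -
  obtain a b c xs p q r where [simp]: "R = ((a, b, c), xs)" "t = (p, q, r)"
    by (cases R; cases t) auto
  have "xs ! j \<in> {0..<32} \<times> {0..<3}"
    using assms by (auto dest: nth_mem)
  then show ?thesis
    using assms by (auto simp: carrier_integer_mod_group mem_Times_iff of_bool_def
        intro!: XOR_upper[of _ 5, simplified])
qed

lemma row_entry_row_diff:
  assumes "row_wf R" "row_wf S" and "j < 12"
  shows "inv\<^bsub>G96\<^esub> row_entry R (j, t) \<otimes>\<^bsub>G96\<^esub> row_entry S (j, t) = row_entry (row_diff R S) (j, t)"
proof -
  obtain a b c xs a' b' c' ys p q r
    where [simp]: "R = ((a, b, c), xs)" "S = ((a', b', c'), ys)" "t = (p, q, r)"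
    by (cases R; cases S; cases t) auto
  show ?thesis
    using row_entry_closed[OF assms(1,3), of t] assms
    by (auto simp: ac_simps of_bool_def split_beta mod_simps simp del: XOR_lower)
qed

text \<open>
  Found by a computer search among the matrices with a symmetry of order 3: the linear map
  \<open>1 \<mapsto> 2, 2 \<mapsto> 3, 4 \<mapsto> 8, 8 \<mapsto> 12, 16 \<mapsto> 16\<close> of \<open>F\<close> followed by a cyclic shift within the three triples of
  rows permutes the base columns cyclically within the four triples of columns.
\<close>

definition rows96 :: "row list" where
  "rows96 =
    [((24, 21, 2), [(0,2), (17,1), (19,2), (4,1), (5,1), (7,2), (20,0), (17,0), (2,1), (23,0), (18,0), (6,1)]),
     ((6, 28, 3), [(17,2), (0,2), (18,1), (9,2), (8,1), (10,1), (3,1), (24,0), (18,0), (11,1), (25,0), (19,0)]),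
     ((31, 11, 1), [(19,1), (18,2), (0,2), (15,1), (14,2), (12,1), (19,0), (1,1), (28,0), (17,0), (13,1), (30,0)]),
     ((4, 3, 14), [(0,0), (0,2), (5,2), (17,2), (11,1), (24,2), (24,2), (10,2), (27,0), (26,0), (12,2), (24,2)]),
     ((9, 8, 7), [(10,2), (0,0), (0,2), (28,2), (18,2), (13,1), (29,0), (28,2), (15,2), (28,2), (31,0), (4,2)]),
     ((2, 14, 9), [(0,2), (15,2), (0,0), (6,1), (20,2), (19,2), (5,2), (22,0), (20,2), (8,2), (20,2), (21,0)]),
     ((22, 5, 4), [(0,0), (0,0), (7,1), (0,1), (8,1), (31,2), (11,0), (2,2), (9,2), (19,1), (19,1), (16,0)]),
     ((17, 27, 8), [(9,1), (0,0), (0,0), (21,2), (0,1), (12,1), (14,2), (13,0), (3,2), (16,0), (17,1), (17,1)]),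
     ((15, 18, 12), [(0,0), (14,1), (0,0), (4,1), (26,2), (0,1), (1,2), (7,2), (6,0), (18,1), (16,0), (18,1)])]"

lemma length_rows96: "length rows96 = 9"
  by (simp add: rows96_def)

lemma row_wf_rows96: "\<forall>R \<in> set rows96. row_wf R"
  by (simp add: rows96_def)

lemma rows96_differences: "sorted_wrt (\<lambda>R S. row_injective (row_diff R S)) rows96"
  by (simp add: rows96_def)

lemma difference_matrix_96:
  "difference_matrix G96 {..<9} ({..<12} \<times> UNIV) (\<lambda>r. row_entry (rows96 ! r))"
proof -
  interpret group G96
    by (simp add: DirProd_group)
  have wf: "row_wf (rows96 ! r)" if "r < 9" for r
    using row_wf_rows96 that by (simp add: length_rows96)
  show ?thesis
  proof (rule difference_matrixI)
    show "finite (carrier G96)"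
      by (simp add: carrier_integer_mod_group)
    show "card ({..<12::nat} \<times> (UNIV :: (bool \<times> bool \<times> bool) set)) = order G96"
      by (simp add: order_def carrier_integer_mod_group card_cartesian_product
          UNIV_Times_UNIV[symmetric] del: UNIV_Times_UNIV)
  next
    fix r :: nat and c :: "nat \<times> bool \<times> bool \<times> bool"
    assume "r \<in> {..<9}" "c \<in> {..<12} \<times> UNIV"
    then show "row_entry (rows96 ! r) c \<in> carrier G96"
      using row_entry_closed[OF wf] by (cases c) auto
  next
    fix r s :: nat assume rs: "r \<in> {..<9}" "s \<in> {..<9}" "r < s"
    define Q where "Q = row_diff (rows96 ! r) (rows96 ! s)"
    have "row_injective Q"
      using rows96_differences rs
      by (simp add: Q_def sorted_wrt_iff_nth_less length_rows96)
    moreover have "length (snd Q) = 12"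
      using wf[of r] wf[of s] rs by (cases "rows96 ! r"; cases "rows96 ! s") (auto simp: Q_def)
    ultimately have "inj_on (row_entry Q) ({..<12} \<times> UNIV)"
      using inj_on_row_entry[of "fst Q" "snd Q"] by simp
    moreover have "inv\<^bsub>G96\<^esub> row_entry (rows96 ! r) c \<otimes>\<^bsub>G96\<^esub> row_entry (rows96 ! s) c = row_entry Q c"
      if "c \<in> {..<12} \<times> UNIV" for c
      using that row_entry_row_diff[OF wf wf] rs by (cases c) (auto simp: Q_def)
    ultimately show
      "inj_on (\<lambda>c. inv\<^bsub>G96\<^esub> row_entry (rows96 ! r) c \<otimes>\<^bsub>G96\<^esub> row_entry (rows96 ! s) c) ({..<12} \<times> UNIV)"
      by (simp cong: inj_on_cong)
  qed
qed

theorem theorem5: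
  shows "mols_number 96 \<ge> 8 \<and> (\<exists>M :: nat mat set. mols 96 M \<and> card M = 8)"
proof -
  interpret group G96
    by (simp add: DirProd_group)
  have "order G96 = 96" "finite (carrier G96)"
    by (simp_all add: order_def carrier_integer_mod_group card_cartesian_product)
  moreover have "card ({..<12::nat} \<times> (UNIV :: (bool \<times> bool \<times> bool) set)) = 96"
    by (simp add: card_cartesian_product UNIV_Times_UNIV[symmetric] del: UNIV_Times_UNIV)
  ultimately obtain M :: "nat mat set" where M: "mols 96 M" "card M = 8"
    using mols_of_difference_matrix[OF _ _ _ _ difference_matrix_96, of 96 0] by auto
  \<comment> \<open>Infinite sets have \<open>card\<close> 0, so the value 8 forces
    finiteness.\<close>
  moreover have "finite M"
    using M(2) by (intro card_ge_0_finite) simp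
  ultimately have "enat 8 \<le> mols_number 96"
    unfolding mols_number_def by (intro Sup_upper) (auto intro!: exI[of _ M])
  then show ?thesis
    using M by (auto simp: numeral_eq_enat)
qed

end
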